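(* Let $\mathcal{C}$ be a small category and let $X\colon\mathcal{C}\to\mathbf{Set}$ be a functor with decomposition $X\cong\coprod_{\lambda\in\Lambda}X_\lambda$ into indecomposable summands. Then, for every $\lambda\in\Lambda$, $$\mathrm{dsecat}(\pi_X)\leq\mathrm{dsecat}(\pi_{X_\lambda}).$$ Consequently, if $\Lambda$ is finite and non-empty, then $\mathrm{dsecat}(\pi_X)\leq\min_{\lambda\in\Lambda}\mathrm{dsecat}(\pi_{X_\lambda})$.
   Context: A functor $X\colon\mathcal{C}\to\mathbf{Set}$ is called a database. Coproducts of databases are computed objectwise. A non-empty database $X$ (i.e. not the constant functor at $\varnothing$) is indecomposable if in every decomposition $X\cong X_1\coprod X_2$ one of the summands is empty. Every database is a coproduct of indecomposable subfunctors, corresponding to the connected components of its category of elements. The category of elements $\int^{\mathcal{C}}X$ has objects $(c,x)$ with $x\in X(c)$; a morphism $(c,x)\to(d,y)$ is a morphism $f\colon c\to d$ in $\mathcal{C}$ with $X(f)(x)=y$. The functor $\pi_X\colon\int^{\mathcal{C}}X\to\mathcal{C}$ is the projection $(c,x)\mapsto c$. A cover of a category $\mathcal{B}$ is a family of (not necessarily full) subcategories such that every morphism of $\mathcal{B}$ belongs to at least one of them. For a functor $P\colon\mathcal{E}\to\mathcal{B}$, the directed sectional category $\mathrm{dsecat}(P)$ is the least integer $n\geq0$ for which $\mathcal{B}$ admits a cover $\{\mathcal{U}_0,\dots,\mathcal{U}_n\}$ and, for every $i$, a functor $s_i\colon\mathcal{U}_i\to\mathcal{E}$ together with a natural transformation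 $P s_i\Rightarrow\iota_i$, where $\iota_i\colon\mathcal{U}_i\hookrightarrow\mathcal{B}$ is the inclusion; it is $\infty$ if no such finite cover exists. *)

theory Defs
  imports Main "HOL-Library.Extended_Nat"
begin

section \<open>Categories, subcategories, functors, natural transformations\<close>

text \<open>
  Objects and morphisms form sets (of arbitrary HOL types), so every category here is small.
  The components of the record are only meaningful on \<open>Obj\<close> and \<open>Mor\<close>, and \<open>Cmp C g f\<close> (read
  \<open>g\<close> after \<open>f\<close>) only if \<open>Cod C f = Dom C g\<close>.
\<close>

record ('o, 'm) cat =
  Obj :: "'o set"
  Mor :: "'m set"
  Dom :: "'m \<Rightarrow> 'o"
  Cod :: "'m \<Rightarrow> 'o"
  Ide :: "'o \<Rightarrow> 'm"
  Cmp :: "'m \<Rightarrow> 'm \<Rightarrow> 'm"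

definition category :: "('o, 'm) cat \<Rightarrow> bool" where
  "category C \<longleftrightarrow>
     (\<forall>f\<in>Mor C. Dom C f \<in> Obj C \<and> Cod C f \<in> Obj C) \<and>
     (\<forall>a\<in>Obj C. Ide C a \<in> Mor C \<and> Dom C (Ide C a) = a \<and> Cod C (Ide C a) = a) \<and>
     (\<forall>f\<in>Mor C. \<forall>g\<in>Mor C. Cod C f = Dom C g \<longrightarrow>
        Cmp C g f \<in> Mor C \<and> Dom C (Cmp C g f) = Dom C f \<and> Cod C (Cmp C g f) = Cod C g) \<and>
     (\<forall>f\<in>Mor C. Cmp C f (Ide C (Dom C f)) = f \<and> Cmp C (Ide C (Cod C f)) f = f) \<and>
     (\<forall>f\<in>Mor C. \<forall>g\<in>Mor C. \<forall>h\<in>Mor C. Cod C f = Dom C g \<and> Cod C g = Dom C h \<longrightarrow>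
        Cmp C h (Cmp C g f) = Cmp C (Cmp C h g) f)"

definition subcategory :: "('o, 'm) cat \<Rightarrow> ('o, 'm) cat \<Rightarrow> bool" where
  "subcategory U C \<longleftrightarrow>
     category U \<and> Obj U \<subseteq> Obj C \<and> Mor U \<subseteq> Mor C \<and>
     (\<forall>f\<in>Mor U. Dom U f = Dom C f \<and> Cod U f = Cod C f) \<and>
     (\<forall>a\<in>Obj U. Ide U a = Ide C a) \<and>
     (\<forall>f\<in>Mor U. \<forall>g\<in>Mor U. Cod C f = Dom C g \<longrightarrow> Cmp U g f = Cmp C g f)"

record ('o, 'm, 'p, 'n) fnctr =
  omap :: "'o \<Rightarrow> 'p"
  mmap :: "'m \<Rightarrow> 'n"

definition is_functor :: "('o, 'm) cat \<Rightarrow> ('p, 'n) cat \<Rightarrow> ('o, 'm, 'p, 'n) fnctr \<Rightarrow> bool" where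
  "is_functor A B F \<longleftrightarrow>
     (\<forall>a\<in>Obj A. omap F a \<in> Obj B) \<and>
     (\<forall>f\<in>Mor A. mmap F f \<in> Mor B \<and>
        Dom B (mmap F f) = omap F (Dom A f) \<and> Cod B (mmap F f) = omap F (Cod A f)) \<and>
     (\<forall>a\<in>Obj A. mmap F (Ide A a) = Ide B (omap F a)) \<and>
     (\<forall>f\<in>Mor A. \<forall>g\<in>Mor A. Cod A f = Dom A g \<longrightarrow>
        mmap F (Cmp A g f) = Cmp B (mmap F g) (mmap F f))"

definition comp_functor ::
    "('p, 'n, 'q, 'k) fnctr \<Rightarrow> ('o, 'm, 'p, 'n) fnctr \<Rightarrow> ('o, 'm, 'q, 'k) fnctr" where
  "comp_functor G F = \<lparr>omap = omap G \<circ> omap F, mmap = mmap G \<circ> mmap F\<rparr>"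

definition inclusion_functor :: "('o, 'm, 'o, 'm) fnctr" where
  "inclusion_functor = \<lparr>omap = (\<lambda>a. a), mmap = (\<lambda>f. f)\<rparr>"

text \<open>\<open>nat_trans A B F G t\<close>: the family \<open>t\<close> is a natural transformation from \<open>F\<close> to \<open>G\<close>,
  both functors from \<open>A\<close> to \<open>B\<close>.\<close>

definition nat_trans ::
    "('o, 'm) cat \<Rightarrow> ('p, 'n) cat \<Rightarrow> ('o, 'm, 'p, 'n) fnctr \<Rightarrow> ('o, 'm, 'p, 'n) fnctr
      \<Rightarrow> ('o \<Rightarrow> 'n) \<Rightarrow> bool" where
  "nat_trans A B F G t \<longleftrightarrow>
     (\<forall>a\<in>Obj A. t a \<in> Mor B \<and> Dom B (t a) = omap F a \<and> Cod B (t a) = omap G a) \<and>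
     (\<forall>f\<in>Mor A. Cmp B (t (Cod A f)) (mmap F f) = Cmp B (mmap G f) (t (Dom A f)))"


section \<open>Directed sectional category\<close>

definition is_cover :: "('o, 'm) cat \<Rightarrow> 'i set \<Rightarrow> ('i \<Rightarrow> ('o, 'm) cat) \<Rightarrow> bool" where
  "is_cover B I U \<longleftrightarrow> (\<forall>i\<in>I. subcategory (U i) B) \<and> (\<forall>f\<in>Mor B. \<exists>i\<in>I. f \<in> Mor (U i))"

definition has_directed_section ::
    "('p, 'n) cat \<Rightarrow> ('o, 'm) cat \<Rightarrow> ('p, 'n, 'o, 'm) fnctr \<Rightarrow> ('o, 'm) cat \<Rightarrow> bool" where
  "has_directed_section E B P U \<longleftrightarrow>
     (\<exists>s t. is_functor U E s \<and> nat_trans U B (comp_functor P s) inclusion_functor t)"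

text \<open>A non-empty set of extended naturals attains its infimum, and the infimum of the empty set
  is \<open>\<infinity>\<close>.\<close>

definition dsecat ::
    "('p, 'n) cat \<Rightarrow> ('o, 'm) cat \<Rightarrow> ('p, 'n, 'o, 'm) fnctr \<Rightarrow> enat" where
  "dsecat E B P =
     Inf {enat n | n. \<exists>U. is_cover B {0..n} U \<and> (\<forall>i\<in>{0..n}. has_directed_section E B P (U i))}"


section \<open>Databases\<close>

text \<open>A set-valued functor; its values are subsets of an arbitrary type \<open>'x\<close>, and \<open>dmor X f\<close> is
  only meaningful on \<open>dobj X (Dom C f)\<close>.\<close>

record ('o, 'm, 'x) db =
  dobj :: "'o \<Rightarrow> 'x set"
  dmor :: "'m \<Rightarrow> 'x \<Rightarrow> 'x"

definition database :: "('o, 'm) cat \<Rightarrow> ('o, 'm, 'x) db \<Rightarrow> bool" where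
  "database C X \<longleftrightarrow>
     (\<forall>f\<in>Mor C. \<forall>x\<in>dobj X (Dom C f). dmor X f x \<in> dobj X (Cod C f)) \<and>
     (\<forall>a\<in>Obj C. \<forall>x\<in>dobj X a. dmor X (Ide C a) x = x) \<and>
     (\<forall>f\<in>Mor C. \<forall>g\<in>Mor C. Cod C f = Dom C g \<longrightarrow>
        (\<forall>x\<in>dobj X (Dom C f). dmor X (Cmp C g f) x = dmor X g (dmor X f x)))"

definition db_isomorphic :: "('o, 'm) cat \<Rightarrow> ('o, 'm, 'x) db \<Rightarrow> ('o, 'm, 'y) db \<Rightarrow> bool" where
  "db_isomorphic C X Y \<longleftrightarrow>
     (\<exists>h. (\<forall>a\<in>Obj C. bij_betw (h a) (dobj X a) (dobj Y a)) \<and>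
          (\<forall>f\<in>Mor C. \<forall>x\<in>dobj X (Dom C f).
             h (Cod C f) (dmor X f x) = dmor Y f (h (Dom C f) x)))"

definition db_empty :: "('o, 'm) cat \<Rightarrow> ('o, 'm, 'x) db \<Rightarrow> bool" where
  "db_empty C X \<longleftrightarrow> (\<forall>a\<in>Obj C. dobj X a = {})"

definition db_sum :: "('o, 'm, 'x) db \<Rightarrow> ('o, 'm, 'y) db \<Rightarrow> ('o, 'm, 'x + 'y) db" where
  "db_sum X Y = \<lparr>dobj = (\<lambda>a. dobj X a <+> dobj Y a),
                 dmor = (\<lambda>f. map_sum (dmor X f) (dmor Y f))\<rparr>"

definition db_coproduct :: "'i set \<Rightarrow> ('i \<Rightarrow> ('o, 'm, 'x) db) \<Rightarrow> ('o, 'm, 'i \<times> 'x) db" where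
  "db_coproduct L Y = \<lparr>dobj = (\<lambda>a. SIGMA l:L. dobj (Y l) a),
                       dmor = (\<lambda>f (l, x). (l, dmor (Y l) f x))\<rparr>"

text \<open>The summands range over databases with values in the same type \<open>'x\<close> as \<open>X\<close>. This loses
  nothing, since summands of \<open>X\<close> are isomorphic to subfunctors of \<open>X\<close>: see
  \<open>indecomposable_any_type\<close> below.\<close>

definition indecomposable :: "('o, 'm) cat \<Rightarrow> ('o, 'm, 'x) db \<Rightarrow> bool" where
  "indecomposable C X \<longleftrightarrow>
     \<not> db_empty C X \<and>
     (\<forall>(X1 :: ('o, 'm, 'x) db) (X2 :: ('o, 'm, 'x) db).
        database C X1 \<and> database C X2 \<and> db_isomorphic C X (db_sum X1 X2) \<longrightarrow>
          db_empty C X1 \<or> db_empty C X2)"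

text \<open>A morphism of the category of elements carries its source and target, since the same
  \<open>f\<close> underlies morphisms out of \<open>(Dom C f, x)\<close> for different \<open>x\<close>.\<close>

definition elements ::
    "('o, 'm) cat \<Rightarrow> ('o, 'm, 'x) db \<Rightarrow> ('o \<times> 'x, ('o \<times> 'x) \<times> 'm \<times> ('o \<times> 'x)) cat" where
  "elements C X = \<lparr>
     Obj = {(c, x). c \<in> Obj C \<and> x \<in> dobj X c},
     Mor = {((c, x), f, (d, y)) | c x f d y.
              c \<in> Obj C \<and> x \<in> dobj X c \<and> d \<in> Obj C \<and> y \<in> dobj X d \<and>
              f \<in> Mor C \<and> Dom C f = c \<and> Cod C f = d \<and> dmor X f x = y},
     Dom = (\<lambda>(p, f, q). p),
     Cod = (\<lambda>(p, f, q). q),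
     Ide = (\<lambda>p. (p, Ide C (fst p), p)),
     Cmp = (\<lambda>(q, g, r) (p, f, q'). (p, Cmp C g f, r))\<rparr>"

definition projection ::
    "('o \<times> 'x, ('o \<times> 'x) \<times> 'm \<times> ('o \<times> 'x), 'o, 'm) fnctr" where
  "projection = \<lparr>omap = fst, mmap = (\<lambda>(p, f, q). f)\<rparr>"


section \<open>Well-definedness\<close>

lemma category_elements:
  assumes "category C" "database C X"
  shows "category (elements C X)"
  using assms unfolding category_def database_def elements_def by auto

lemma is_functor_projection:
  assumes "category C"
  shows "is_functor (elements C X) C projection"
  using assms unfolding category_def is_functor_def elements_def projection_def by auto

lemma is_functor_inclusion:
  assumes "subcategory U C"
  shows "is_functor U C inclusion_functor"
  using assms unfolding subcategory_def is_functor_def inclusion_functor_def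
  by (auto simp: subset_iff)

lemma database_db_sum:
  assumes "database C X" "database C Y"
  shows "database C (db_sum X Y)"
  using assms unfolding database_def db_sum_def by auto

lemma database_db_coproduct:
  assumes "\<And>l. l \<in> L \<Longrightarrow> database C (Y l)"
  shows "database C (db_coproduct L Y)"
  using assms unfolding database_def db_coproduct_def by auto

lemma dsecat_le_iff:
  "dsecat E B P \<le> enat n \<longleftrightarrow>
     (\<exists>m\<le>n. \<exists>U. is_cover B {0..m} U \<and> (\<forall>i\<in>{0..m}. has_directed_section E B P (U i)))"
proof -
  define S where "S = {enat n | n. \<exists>U. is_cover B {0..n} U \<and>
    (\<forall>i\<in>{0..n}. has_directed_section E B P (U i))}"
  have eq: "dsecat E B P = Inf S" by (simp add: dsecat_def S_def)
  have "Inf S \<le> enat n \<longleftrightarrow> (\<exists>k\<in>S. k \<le> enat n)"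
  proof
    assume le: "Inf S \<le> enat n"
    then have "S \<noteq> {}" by (auto simp: Inf_enat_def)
    then have "Inf S \<in> S" by (metis Inf_enat_def LeastI ex_in_conv)
    with le show "\<exists>k\<in>S. k \<le> enat n" by blast
  qed (meson Inf_lower order_trans)
  also have "\<dots> \<longleftrightarrow> (\<exists>m\<le>n. enat m \<in> S)" by (metis enat_ile enat_ord_simps(1))
  finally show ?thesis unfolding eq by (simp add: S_def)
qed

lemma indecomposable_any_type:
  fixes X :: "('o, 'm, 'x) db" and Y :: "('o, 'm, 'y) db" and Z :: "('o, 'm, 'z) db"
  assumes C: "category C" and X: "database C X" and ind: "indecomposable C X"
    and Y: "database C Y" and Z: "database C Z"
    and iso: "db_isomorphic C X (db_sum Y Z)"
  shows "db_empty C Y \<or> db_empty C Z"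
proof -
  obtain h where bij: "\<And>a. a \<in> Obj C \<Longrightarrow> bij_betw (h a) (dobj X a) (dobj Y a <+> dobj Z a)"
    and nat: "\<And>f x. f \<in> Mor C \<Longrightarrow> x \<in> dobj X (Dom C f) \<Longrightarrow>
        h (Cod C f) (dmor X f x) = map_sum (dmor Y f) (dmor Z f) (h (Dom C f) x)"
    using iso by (auto simp: db_isomorphic_def db_sum_def)
  define X1 where "X1 = X\<lparr>dobj := \<lambda>a. {x \<in> dobj X a. isl (h a x)}\<rparr>"
  define X2 where "X2 = X\<lparr>dobj := \<lambda>a. {x \<in> dobj X a. \<not> isl (h a x)}\<rparr>"
  have isl: "isl (map_sum p q z) = isl z" for p :: "'y \<Rightarrow> 'y" and q :: "'z \<Rightarrow> 'z" and z
    by (cases z) auto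
  have X1: "database C X1" and X2: "database C X2"
    using X nat C unfolding X1_def X2_def database_def category_def by (auto simp: isl)
  have "db_isomorphic C X (db_sum X1 X2)"
    unfolding db_isomorphic_def
  proof (intro exI[of _ "\<lambda>a x. if isl (h a x) then Inl x else Inr x"] conjI ballI)
    fix a
    show "bij_betw (\<lambda>x. if isl (h a x) then Inl x else Inr x) (dobj X a) (dobj (db_sum X1 X2) a)"
      by (auto simp: bij_betw_def inj_on_def db_sum_def X1_def X2_def image_iff split: if_splits)
  next
    fix f x assume "f \<in> Mor C" "x \<in> dobj X (Dom C f)"
    then show "(if isl (h (Cod C f) (dmor X f x)) then Inl (dmor X f x) else Inr (dmor X f x)) =
      dmor (db_sum X1 X2) f (if isl (h (Dom C f) x) then Inl x else Inr x)"
      using nat by (auto simp: isl db_sum_def X1_def X2_def)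
  qed
  with ind X1 X2 have "db_empty C X1 \<or> db_empty C X2"
    unfolding indecomposable_def by blast
  then show ?thesis
  proof
    assume e: "db_empty C X1"
    have "dobj Y a = {}" if a: "a \<in> Obj C" for a
    proof (rule ccontr)
      assume "dobj Y a \<noteq> {}"
      then obtain y where "Inl y \<in> dobj Y a <+> dobj Z a" by blast
      then obtain x where "x \<in> dobj X a" "h a x = Inl y"
        using bij[OF a] by (metis bij_betw_def imageE)
      then have "x \<in> dobj X1 a" by (simp add: X1_def)
      then show False using e a by (simp add: db_empty_def)
    qed
    then show ?thesis by (simp add: db_empty_def)
  next
    assume e: "db_empty C X2"
    have "dobj Z a = {}" if a: "a \<in> Obj C" for a
    proof (rule ccontr)
      assume "dobj Z a \<noteq> {}"
      then obtain y where "Inr y \<in> dobj Y a <+> dobj Z a" by blast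
      then obtain x where "x \<in> dobj X a" "h a x = Inr y"
        using bij[OF a] by (metis bij_betw_def imageE)
      then have "x \<in> dobj X2 a" by (simp add: X2_def)
      then show False using e a by (simp add: db_empty_def)
    qed
    then show ?thesis by (simp add: db_empty_def)
  qed
qed

end

theory Submission
  imports Defs
begin

text \<open>A morphism of databases \<open>Y \<rightarrow> X\<close> induces a functor between the categories of elements that
  commutes with the projections to \<open>C\<close>. Composing with it turns directed sections of \<open>\<pi>\<^sub>Y\<close> into
  directed sections of \<open>\<pi>\<^sub>X\<close> over the same subcategories. The theorem is the case of the coproduct
  injections.\<close>

definition db_morphism ::
    "('o, 'm) cat \<Rightarrow> ('o, 'm, 'x) db \<Rightarrow> ('o, 'm, 'y) db \<Rightarrow> ('o \<Rightarrow> 'x \<Rightarrow> 'y) \<Rightarrow> bool" where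
  "db_morphism C X Y g \<longleftrightarrow>
     (\<forall>a\<in>Obj C. \<forall>x\<in>dobj X a. g a x \<in> dobj Y a) \<and>
     (\<forall>f\<in>Mor C. \<forall>x\<in>dobj X (Dom C f). g (Cod C f) (dmor X f x) = dmor Y f (g (Dom C f) x))"

text \<open>A morphism of \<open>elements\<close> records both its endpoints, so \<open>g\<close>
  has to be applied at each end. The underlying morphism of \<open>C\<close> stays fixed, which
  makes the functor commute with \<open>projection\<close> strictly.\<close>

definition elements_map ::
    "('o \<Rightarrow> 'x \<Rightarrow> 'y) \<Rightarrow> ('o \<times> 'x, ('o \<times> 'x) \<times> 'm \<times> ('o \<times> 'x),
      'o \<times> 'y, ('o \<times> 'y) \<times> 'm \<times> ('o \<times> 'y)) fnctr" where
  "elements_map g = \<lparr>omap = (\<lambda>(c, x). (c, g c x)),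
     mmap = (\<lambda>((c, x), f, (d, y)). ((c, g c x), f, (d, g d y)))\<rparr>"

lemma is_functor_elements_map:
  assumes "db_morphism C X Y g"
  shows "is_functor (elements C X) (elements C Y) (elements_map g)"
  using assms unfolding db_morphism_def is_functor_def elements_def elements_map_def
  by auto metis

lemma is_functor_comp:
  assumes "category A" "is_functor A B F" "is_functor B D G"
  shows "is_functor A D (comp_functor G F)"
  using assms unfolding category_def is_functor_def comp_functor_def by simp

text \<open>The new section is \<open>K\<close> after the old one. Since \<open>P'\<close> after
  \<open>K\<close> agrees with \<open>P\<close> on \<open>E\<close>, where the old section takes its
  values, the same components \<open>t\<close> remain natural.\<close>

lemma has_directed_section_comp:
  assumes U: "category U" and K: "is_functor E E' K"
    and obj: "\<And>e. e \<in> Obj E \<Longrightarrow> omap P' (omap K e) = omap P e"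
    and mor: "\<And>f. f \<in> Mor E \<Longrightarrow> mmap P' (mmap K f) = mmap P f"
    and "has_directed_section E B P U"
  shows "has_directed_section E' B P' U"
proof -
  obtain s t where s: "is_functor U E s"
    and t: "nat_trans U B (comp_functor P s) inclusion_functor t"
    using assms(5) unfolding has_directed_section_def by blast
  have "nat_trans U B (comp_functor P' (comp_functor K s)) inclusion_functor t"
    using s t obj mor unfolding nat_trans_def comp_functor_def is_functor_def by simp
  then show ?thesis
    using is_functor_comp[OF U s K] unfolding has_directed_section_def by blast
qed

text \<open>Every cover that is admissible for \<open>P\<close> is admissible for \<open>P'\<close>,
  so the infimum for \<open>P'\<close> runs over a larger set. This includes the case of the value
  \<infinity>, where the set for \<open>P\<close> is empty.\<close>

lemma dsecat_mono:
  assumes "\<And>U. subcategory U B \<Longrightarrow> has_directed_section E B P U \<Longrightarrow> has_directed_section E' B P' U"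
  shows "dsecat E' B P' \<le> dsecat E B P"
  unfolding dsecat_def
proof (rule Inf_superset_mono, clarify)
  fix n :: nat and U
  assume "is_cover B {0..n} U" "\<forall>i\<in>{0..n}. has_directed_section E B P (U i)"
  then show "\<exists>m. enat n = enat m \<and>
      (\<exists>U. is_cover B {0..m} U \<and> (\<forall>i\<in>{0..m}. has_directed_section E' B P' (U i)))"
    using assms unfolding is_cover_def by blast
qed

lemma dsecat_projection_le:
  assumes "db_morphism C Y X g"
  shows "dsecat (elements C X) C projection \<le> dsecat (elements C Y) C projection"
proof (rule dsecat_mono)
  fix U
  assume "subcategory U C" and sec: "has_directed_section (elements C Y) C projection U"
  then have "category U" by (simp add: subcategory_def)
  then show "has_directed_section (elements C X) C projection U"
    by (rule has_directed_section_comp[OF _ is_functor_elements_map[OF assms] _ _ sec])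
      (auto simp: projection_def elements_map_def)
qed

lemma db_morphism_coproduct_injection:
  assumes "l \<in> L"
  shows "db_morphism C (Y l) (db_coproduct L Y) (\<lambda>_ y. (l, y))"
  using assms by (simp add: db_morphism_def db_coproduct_def)

lemma db_morphism_comp:
  assumes "category C" "db_morphism C X Y g" "db_morphism C Y Z h"
  shows "db_morphism C X Z (\<lambda>a. h a \<circ> g a)"
  using assms unfolding db_morphism_def category_def by simp

text \<open>The given isomorphism starts at \<open>X\<close>, while the coproduct injections have to
  be continued into \<open>X\<close>. The pointwise inverse is natural because the isomorphism
  is.\<close>

lemma db_isomorphic_imp_inverse_morphism:
  assumes C: "category C" and X: "database C X" and iso: "db_isomorphic C X Y"
  obtains k where "db_morphism C Y X k"
proof -
  obtain h where bij: "\<And>a. a \<in> Obj C \<Longrightarrow> bij_betw (h a) (dobj X a) (dobj Y a)"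
    and nat: "\<And>f x. f \<in> Mor C \<Longrightarrow> x \<in> dobj X (Dom C f) \<Longrightarrow>
        h (Cod C f) (dmor X f x) = dmor Y f (h (Dom C f) x)"
    using iso unfolding db_isomorphic_def by blast
  define k where "k a = inv_into (dobj X a) (h a)" for a
  have k: "k a y \<in> dobj X a" "h a (k a y) = y" if "a \<in> Obj C" "y \<in> dobj Y a" for a y
    using bij[OF that(1)] that(2) unfolding k_def
    by (auto simp: bij_betw_def inv_into_into f_inv_into_f)
  have "k (Cod C f) (dmor Y f y) = dmor X f (k (Dom C f) y)"
    if f: "f \<in> Mor C" and y: "y \<in> dobj Y (Dom C f)" for f y
  proof -
    have ob: "Dom C f \<in> Obj C" "Cod C f \<in> Obj C" using C f by (auto simp: category_def)
    have x: "k (Dom C f) y \<in> dobj X (Dom C f)" "h (Dom C f) (k (Dom C f) y) = y"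
      using k[OF ob(1) y] .
    have "dmor X f (k (Dom C f) y) \<in> dobj X (Cod C f)"
      using X f x(1) by (simp add: database_def)
    \<comment> \<open>Cancelling \<open>k\<close> against \<open>h\<close> at the codomain requires
      an argument in \<open>dobj X (Cod C f)\<close>; naturality of \<open>h\<close> then rewrites
      the inner term to \<open>dmor Y f y\<close>.\<close>
    then have "k (Cod C f) (h (Cod C f) (dmor X f (k (Dom C f) y))) = dmor X f (k (Dom C f) y)"
      using bij[OF ob(2)] unfolding k_def by (simp add: bij_betw_def inv_into_f_f)
    then show ?thesis using nat[OF f x(1)] x(2) by simp
  qed
  with k(1) have "db_morphism C Y X k" by (simp add: db_morphism_def)
  then show ?thesis by (rule that)
qed

theorem theorem7p4:
  fixes C :: "('o, 'm) cat"
    and X :: "('o, 'm, 'x) db"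
    and L :: "'i set"
    and Y :: "'i \<Rightarrow> ('o, 'm, 'y) db"
  assumes "category C"
    and "database C X"
    and "\<And>l. l \<in> L \<Longrightarrow> database C (Y l)"
    and "\<And>l. l \<in> L \<Longrightarrow> indecomposable C (Y l)"
    and "db_isomorphic C X (db_coproduct L Y)"
  shows "(\<forall>l\<in>L. dsecat (elements C X) C projection \<le> dsecat (elements C (Y l)) C projection) \<and>
         (finite L \<and> L \<noteq> {} \<longrightarrow>
            dsecat (elements C X) C projection
              \<le> Min ((\<lambda>l. dsecat (elements C (Y l)) C projection) ` L))"
proof -
  obtain k where k: "db_morphism C (db_coproduct L Y) X k"
    using db_isomorphic_imp_inverse_morphism[OF assms(1,2,5)] .
  have "dsecat (elements C X) C projection \<le> dsecat (elements C (Y l)) C projection"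
    if "l \<in> L" for l
    \<comment> \<open>The morphism used is the injection of \<open>Y l\<close> into the coproduct,
      followed by \<open>k\<close>.\<close>
    using db_morphism_comp[OF assms(1) db_morphism_coproduct_injection[OF that] k]
    by (rule dsecat_projection_le)
  then show ?thesis by simp
qed

end
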